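(* Let $\mu$ be a positive Borel measure with support in $\mathbb{R}_+=[0,\infty)$ having finite moments $s_n=\int_{\mathbb{R}_+} t^n\,d\mu(t)$ for every integer $n\ge 0$. Then the following conditions are equivalent: (i) $\mu$ is a finite combination of Dirac measures; (ii) there exist integers $p,k\ge 0$ such that $\det\big((s_{i+j+p})_{0\le i,j\le k}\big)=0$.
   Context: A measure is a finite combination of Dirac measures if it is of the form $\sum_{l} a_l\delta_{x_l}$ with finitely many terms, equivalently if it has finite support. *)

theory Defs
  imports "HOL-Probability.Giry_Monad" "Jordan_Normal_Form.Determinant"
begin

definition measure_support :: "'a::topological_space measure \<Rightarrow> 'a set" where
  "measure_support M = {x. \<forall>U. open U \<longrightarrow> x \<in> U \<longrightarrow> emeasure M U > 0}"

text \<open>The Dirac measure at \<open>x\<close> is \<^term>\<open>return borel x\<close>. The points need not be distinct and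
  the coefficients are arbitrary reals, so the defining identity is stated for the real-valued
  \<^const>\<open>measure\<close>; the conjunct \<^const>\<open>finite_measure\<close> ensures that this determines the measure.
  The empty combination \<open>n = 0\<close> is the zero measure.\<close>

definition finite_dirac_combination :: "'a::topological_space measure \<Rightarrow> bool" where
  "finite_dirac_combination M \<longleftrightarrow> sets M = sets borel \<and> finite_measure M \<and>
     (\<exists>(n::nat) (a :: nat \<Rightarrow> real) (x :: nat \<Rightarrow> 'a). \<forall>A\<in>sets borel.
        measure M A = (\<Sum>l<n. a l * measure (return borel (x l)) A))"

definition moment :: "real measure \<Rightarrow> nat \<Rightarrow> real" where
  "moment M n = (LINT t:{0..}|M. t ^ n)"

text \<open>The names \<open>det\<close> and \<open>mat\<close> are qualified because HOL-Analysis uses them for matrices indexed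
  by types; here the size \<open>k + 1\<close> varies.\<close>

definition hankel_det :: "(nat \<Rightarrow> real) \<Rightarrow> nat \<Rightarrow> nat \<Rightarrow> real" where
  "hankel_det s p k = Determinant.det (Matrix.mat (k + 1) (k + 1) (\<lambda>(i, j). s (i + j + p)))"

end

theory Submission
  imports Defs
begin

text \<open>Since \<open>\<Sum>\<^sub>i\<^sub>j v\<^sub>i v\<^sub>j s\<^sub>i\<^sub>+\<^sub>j\<^sub>+\<^sub>p = \<integral> t\<^sup>p q(t)\<^sup>2 d\<mu>\<close> with \<open>q = \<Sum>\<^sub>j v\<^sub>j t\<^sup>j\<close>,
  a kernel vector of a Hankel matrix forces \<open>\<mu>\<close> to live on the zeros of the nonzero polynomial
  \<open>t\<^sup>p q(t)\<^sup>2\<close>. Conversely, the coefficients of a monic polynomial vanishing on a finite set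
  that carries \<open>\<mu>\<close> form a kernel vector of the Hankel matrix with \<open>p = 0\<close>.\<close>

text \<open>Each point outside the support has a null open neighbourhood, which can be shrunk to a
  null set of a countable basis. The complement is therefore covered by countably many null
  sets.\<close>

lemma AE_measure_support:
  fixes M :: "'a::second_countable_topology measure"
  assumes "sets M = sets borel"
  shows "AE x in M. x \<in> measure_support M"
proof -
  obtain B :: "'a set set" where B: "countable B" "topological_basis B"
    using ex_countable_basis by blast
  define N where "N = {b \<in> B. emeasure M b = 0}"
  have "b \<in> null_sets M" if "b \<in> N" for b
    using that topological_basis_open[OF B(2)] assms by (auto simp: N_def null_sets_def)
  moreover have "countable N"
    using B(1) by (simp add: N_def)
  ultimately have "\<Union>N \<in> null_sets M"
    using null_sets_UN'[of N "\<lambda>b. b" M] by simp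
  moreover have "x \<in> \<Union>N" if x: "x \<notin> measure_support M" for x
  proof -
    obtain U where U: "open U" "x \<in> U" "emeasure M U = 0"
      using x by (auto simp: measure_support_def)
    obtain b where b: "b \<in> B" "x \<in> b" "b \<subseteq> U"
      using topological_basisE[OF B(2) U(1,2)] by blast
    then have "emeasure M b = 0"
      using emeasure_mono[of b U M] U assms by simp
    with b show ?thesis
      by (auto simp: N_def)
  qed
  ultimately show ?thesis
    by (intro AE_I'[of "\<Union>N"]) auto
qed

text \<open>This turns condition (i) into a statement about null sets, the form that integrals of
  polynomials can produce and use. Signs of the coefficients and repeated points are harmless: only
  the set of points matters in one direction, and in the other the point masses serve as
  coefficients.\<close>

lemma finite_dirac_combination_iff_AE_finite:
  fixes M :: "'a::t1_space measure"
  assumes sets: "sets M = sets borel" and fin: "finite_measure M"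
  shows "finite_dirac_combination M \<longleftrightarrow> (\<exists>F. finite F \<and> (AE x in M. x \<in> F))"
proof
  assume "finite_dirac_combination M"
  then obtain n :: nat and a :: "nat \<Rightarrow> real" and x :: "nat \<Rightarrow> 'a"
    where M: "\<And>A. A \<in> sets borel \<Longrightarrow>
      measure M A = (\<Sum>l<n. a l * measure (return borel (x l)) A)"
    by (auto simp: finite_dirac_combination_def)
  define F where "F = x ` {..<n}"
  have F: "finite F" "- F \<in> sets borel"
    by (auto simp: F_def intro!: borel_open open_Compl finite_imp_closed)
  \<comment> \<open>Every Dirac term vanishes on \<open>- F\<close>, so no cancellation between
    coefficients of different sign is involved.\<close>
  then have "measure M (- F) = 0"
    by (simp add: M, intro sum.neutral) (auto simp: measure_return F_def)
  then have "- F \<in> null_sets M"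
    using F sets finite_measure.emeasure_eq_measure[OF fin] by (auto simp: null_sets_def)
  then have "AE y in M. y \<in> F"
    by (intro AE_I'[of "- F"]) auto
  with F show "\<exists>F. finite F \<and> (AE x in M. x \<in> F)"
    by blast
next
  assume "\<exists>F. finite F \<and> (AE x in M. x \<in> F)"
  then obtain F where F: "finite F" "AE x in M. x \<in> F"
    by blast
  interpret finite_measure M by (rule fin)
  obtain x :: "nat \<Rightarrow> 'a" where x: "bij_betw x {..<card F} F"
    using ex_bij_betw_nat_finite[OF F(1)] by (auto simp: atLeast0LessThan)
  have singleton: "{y} \<in> sets M" for y
    using sets by simp
  have "measure M A = (\<Sum>l<card F. measure M {x l} * measure (return borel (x l)) A)"
    if A: "A \<in> sets borel" for A
  proof -
    have AF: "finite (A \<inter> F)"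
      using F by simp
    \<comment> \<open>Cutting \<open>A\<close> down to \<open>A \<inter> F\<close> changes it only
      by a null set and leaves a finite set, whose measure is the sum of its point masses.\<close>
    have "measure M A = measure M (A \<inter> F)"
      using F A sets AF
      by (intro finite_measure_eq_AE) (auto intro!: sets.Int borel_closed finite_imp_closed)
    also have "\<dots> = (\<Sum>y\<in>A \<inter> F. measure M {y})"
      using AF singleton by (intro finite_measure_eq_sum_singleton)
    also have "\<dots> = (\<Sum>y\<in>F. measure M {y} * indicator A y)"
      using F by (intro sum.mono_neutral_cong_left) (auto simp: indicator_def split: if_splits)
    also have "\<dots> = (\<Sum>l<card F. measure M {x l} * indicator A (x l))"
      using sum.reindex_bij_betw[OF x, of "\<lambda>y. measure M {y} * indicator A y"] by simp
    finally show ?thesis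
      using A by (simp add: measure_return)
  qed
  then show "finite_dirac_combination M"
    unfolding finite_dirac_combination_def using sets fin
    by (intro conjI exI[of _ "card F"] exI[of _ "\<lambda>l. measure M {x l}"] exI[of _ x]) simp_all
qed

lemma set_integral_sum:
  fixes f :: "'i \<Rightarrow> 'a \<Rightarrow> 'b::{banach, second_countable_topology}"
  assumes "\<And>i. i \<in> I \<Longrightarrow> set_integrable M A (f i)"
  shows "set_integrable M A (\<lambda>x. \<Sum>i\<in>I. f i x)"
    and "(LINT x:A|M. (\<Sum>i\<in>I. f i x)) = (\<Sum>i\<in>I. LINT x:A|M. f i x)"
  using assms by (simp_all add: set_integrable_def set_lebesgue_integral_def scaleR_sum_right)

text \<open>With \<open>i + p\<close> in place of \<open>p\<close>, the right-hand side is row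
  \<open>i\<close> of the Hankel matrix applied to \<open>c\<close>. The kernel equations thus say
  that the polynomial with coefficients \<open>c\<close> is orthogonal to each \<open>t ^ i\<close>
  with respect to the weight \<open>t ^ p\<close>.\<close>

lemma moment_functional_poly:
  fixes M :: "real measure"
  assumes int: "\<And>n::nat. set_integrable M {0..} (\<lambda>t. t ^ n)"
  shows "set_integrable M {0..} (\<lambda>t. t ^ p * (\<Sum>j<n. c j * t ^ j))"
    and "(LINT t:{0..}|M. t ^ p * (\<Sum>j<n. c j * t ^ j)) = (\<Sum>j<n. c j * moment M (j + p))"
proof -
  have eq: "t ^ p * (\<Sum>j<n. c j * t ^ j) = (\<Sum>j<n. c j * t ^ (j + p))" for t
    by (simp add: sum_distrib_left power_add mult_ac)
  have summand: "set_integrable M {0..} (\<lambda>t. c j * t ^ (j + p))" for j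
    using int[of "j + p"] by simp
  show "set_integrable M {0..} (\<lambda>t. t ^ p * (\<Sum>j<n. c j * t ^ j))"
    unfolding eq using summand by (intro set_integral_sum)
  show "(LINT t:{0..}|M. t ^ p * (\<Sum>j<n. c j * t ^ j)) = (\<Sum>j<n. c j * moment M (j + p))"
    unfolding eq by (simp add: set_integral_sum(2)[OF summand] moment_def)
qed

text \<open>A singular matrix over a field has a nonzero kernel vector. The vector is given as a
  function on \<open>nat\<close>, so that it can be read directly as a family of polynomial
  coefficients; only its values below \<open>k + 1\<close> matter.\<close>

lemma hankel_det_eq_0_iff:
  "hankel_det s p k = 0 \<longleftrightarrow>
    (\<exists>c. (\<exists>j<k + 1. c j \<noteq> 0) \<and> (\<forall>i<k + 1. (\<Sum>j<k + 1. c j * s (i + j + p)) = 0))"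
proof -
  let ?H = "Matrix.mat (k + 1) (k + 1) (\<lambda>(i, j). s (i + j + p))"
  have carr: "?H \<in> carrier_mat (k + 1) (k + 1)"
    by simp
  have mv: "?H *\<^sub>v Matrix.vec (k + 1) c = 0\<^sub>v (k + 1) \<longleftrightarrow>
      (\<forall>i<k + 1. (\<Sum>j<k + 1. c j * s (i + j + p)) = 0)" for c
    by (auto simp: Matrix.vec_eq_iff scalar_prod_def atLeast0LessThan mult.commute)
  have nz: "Matrix.vec (k + 1) c \<noteq> 0\<^sub>v (k + 1) \<longleftrightarrow> (\<exists>j<k + 1. c j \<noteq> 0)" for c :: "nat \<Rightarrow> real"
    by (auto simp: Matrix.vec_eq_iff)
  have "hankel_det s p k = 0 \<longleftrightarrow>
      (\<exists>v. v \<in> carrier_vec (k + 1) \<and> v \<noteq> 0\<^sub>v (k + 1) \<and> ?H *\<^sub>v v = 0\<^sub>v (k + 1))"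
    unfolding hankel_det_def by (rule det_0_iff_vec_prod_zero_field[OF carr])
  also have "\<dots> \<longleftrightarrow> (\<exists>c. Matrix.vec (k + 1) c \<noteq> 0\<^sub>v (k + 1) \<and>
      ?H *\<^sub>v Matrix.vec (k + 1) c = 0\<^sub>v (k + 1))" (is "(\<exists>v. ?P v) \<longleftrightarrow> (\<exists>c. ?Q c)")
  proof
    assume "\<exists>v. ?P v"
    then obtain v where v: "?P v" ..
    then have "Matrix.vec (k + 1) (vec_index v) = v"
      by auto
    with v have "?Q (vec_index v)"
      by simp
    then show "\<exists>c. ?Q c"
      by (rule exI[of _ "vec_index v"])
  next
    assume "\<exists>c. ?Q c"
    then obtain c where "?Q c" ..
    then have "?P (Matrix.vec (k + 1) c)"
      by simp
    then show "\<exists>v. ?P v"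
      by (rule exI[of _ "Matrix.vec (k + 1) c"])
  qed
  finally show ?thesis
    unfolding mv nz .
qed

theorem theorem3p5:
  fixes M :: "real measure"
  assumes "sets M = sets borel"
    and "measure_support M \<subseteq> {0..}"
    and "\<And>n::nat. set_integrable M {0..} (\<lambda>t. t ^ n)"
  shows "finite_dirac_combination M \<longleftrightarrow> (\<exists>p k. hankel_det (moment M) p k = 0)"
proof -
  note int = moment_functional_poly[OF assms(3)]
  have nonneg: "AE t in M. t \<ge> 0"
    using AE_measure_support[OF assms(1)] assms(2) by auto
  \<comment> \<open>The moment of order 0 bounds only the mass of \<open>{0..}\<close>; the support
    condition makes this the total mass.\<close>
  have fin: "finite_measure M"
  proof
    have "integrable M (indicator {0..} :: real \<Rightarrow> real)"
      using assms(3)[of 0] by (simp add: set_integrable_def)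
    then have "emeasure M {0..} < \<infinity>"
      using assms(1) by (simp add: integrable_indicator_iff)
    moreover have "emeasure M (space M) = emeasure M {0..}"
      using nonneg assms(1) by (intro emeasure_eq_AE) auto
    ultimately show "emeasure M (space M) \<noteq> \<infinity>"
      by simp
  qed
  show ?thesis
    unfolding finite_dirac_combination_iff_AE_finite[OF assms(1) fin]
  proof
    assume "\<exists>F. finite F \<and> (AE t in M. t \<in> F)"
    then obtain F where F: "finite F" "AE t in M. t \<in> F"
      by blast
    \<comment> \<open>The degree of \<open>P\<close> is the number of points of \<open>F\<close>. If
      \<open>F\<close> is empty, then \<open>P\<close> is 1 and the matrix below is the single entry
      \<open>moment M 0\<close>, which is then 0.\<close>
    define P where "P = (\<Prod>y\<in>F. [:- y, 1:])"
    have "P \<noteq> 0"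
      using F by (auto simp: P_def)
    have P: "poly P t = (\<Sum>j<degree P + 1. coeff P j * t ^ j)" for t
      by (simp add: poly_altdef lessThan_Suc_atMost)
    \<comment> \<open>The summand \<open>0\<close> is the shift \<open>p = 0\<close>, kept to match
      the kernel equations of \<open>hankel_det_eq_0_iff\<close>.\<close>
    have "(\<Sum>j<degree P + 1. coeff P j * moment M (i + j + 0)) = 0" for i
    proof -
      have "(\<Sum>j<degree P + 1. coeff P j * moment M (i + j + 0)) =
          (LINT t:{0..}|M. t ^ i * poly P t)"
        unfolding P int(2) by (simp add: add.commute)
      also have "\<dots> = 0"
      proof -
        have "AE t in M. indicator {0..} t *\<^sub>R (t ^ i * poly P t) = 0"
          using F(2) by eventually_elim (use F(1) in \<open>auto simp: P_def poly_prod prod_zero\<close>)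
        then show ?thesis
          unfolding set_lebesgue_integral_def by (rule integral_eq_zero_AE)
      qed
      finally show ?thesis .
    qed
    moreover have "coeff P (degree P) \<noteq> 0"
      using \<open>P \<noteq> 0\<close> by simp
    ultimately have "hankel_det (moment M) 0 (degree P) = 0"
      unfolding hankel_det_eq_0_iff by (intro exI[of _ "coeff P"]) auto
    then show "\<exists>p k. hankel_det (moment M) p k = 0"
      by blast
  next
    assume "\<exists>p k. hankel_det (moment M) p k = 0"
    then obtain p k c where c: "\<exists>j<k + 1. c j \<noteq> 0"
      and ker: "\<And>i. i < k + 1 \<Longrightarrow> (\<Sum>j<k + 1. c j * moment M (i + j + p)) = 0"
      unfolding hankel_det_eq_0_iff by blast
    define q where "q t = (\<Sum>j<k + 1. c j * t ^ j)" for t :: real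
    \<comment> \<open>Only one factor \<open>q t\<close> is expanded; the other stays whole, so that
      each summand integrates to \<open>c i\<close> times row \<open>i\<close> of the kernel
      equations.\<close>
    have sq: "t ^ p * (q t)\<^sup>2 = (\<Sum>i<k + 1. c i * (t ^ (i + p) * q t))" for t
      by (simp add: q_def[of t] power2_eq_square sum_distrib_right sum_distrib_left power_add mult_ac
          del: sum.lessThan_Suc)
    have summand: "set_integrable M {0..} (\<lambda>t. c i * (t ^ (i + p) * q t))" for i
      unfolding q_def by (intro set_integrable_mult_right int(1))
    have "(LINT t:{0..}|M. t ^ p * (q t)\<^sup>2) =
        (\<Sum>i<k + 1. c i * (LINT t:{0..}|M. t ^ (i + p) * q t))"
      unfolding sq by (subst set_integral_sum(2)[OF summand]) simp
    also have "\<dots> = 0"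
      using ker by (intro sum.neutral) (simp add: q_def int(2) add_ac del: sum.lessThan_Suc)
    finally have zero: "(LINT t:{0..}|M. t ^ p * (q t)\<^sup>2) = 0" .
    have "set_integrable M {0..} (\<lambda>t. t ^ p * (q t)\<^sup>2)"
      unfolding sq using summand by (intro set_integral_sum)
    \<comment> \<open>Restricting to \<open>{0..}\<close> makes the integrand nonnegative even for
      odd \<open>p\<close>, so its zero integral forces it to vanish almost everywhere.\<close>
    then have "AE t in M. indicator {0..} t *\<^sub>R (t ^ p * (q t)\<^sup>2) = 0"
      using zero unfolding set_integrable_def set_lebesgue_integral_def
      by (subst (asm) integral_nonneg_eq_0_iff_AE) (auto simp: indicator_def)
    \<comment> \<open>The point 0 is added because for \<open>p > 0\<close> the factor
      \<open>t ^ p\<close> vanishes there, which leaves \<open>q 0\<close> undetermined.\<close>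
    then have "AE t in M. t \<in> insert 0 {t. q t = 0}"
      using nonneg by eventually_elim auto
    moreover have "finite {t. q t = 0}"
      using c polyfun_finite_roots[of c k]
      by (simp add: q_def lessThan_Suc_atMost less_Suc_eq_le del: sum.lessThan_Suc)
    ultimately show "\<exists>F. finite F \<and> (AE t in M. t \<in> F)"
      by (intro exI[of _ "insert 0 {t. q t = 0}"]) auto
  qed
qed

end
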